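(* Let $R$ be a rotational surface in $\mathbb{E}^3$ given by $\Phi(s,\theta)=(f(s)\cos\theta,f(s)\sin\theta,g(s))$ with $f'^2(s)+g'^2(s)=1$. Then a parametrization of a loxodrome on $R$ (parametrized by arc length $t$) is given by $$\alpha(t)=\big(f(s(t))\cos\theta(t),\ f(s(t))\sin\theta(t),\ g(s(t))\big),$$ where $$s(t)=(\cos\psi)\,t+c\quad\text{and}\quad \theta(t)=\varepsilon\sin\psi\int_{t_0}^{t}\frac{d\xi}{f(s(\xi))}$$ for constants $c,t_0$, $\varepsilon=\pm1$ and $\psi\in[0,\pi]$.
   Context: $R$ is a surface of revolution whose profile curve, with components $f(s),g(s)$, is parametrized by arc length $s$; $\Phi$ is an immersion. Primes denote $d/ds$. Meridians of $R$ are the curves $\gamma_\theta(s)=\Phi(s,\theta)$ with $\theta$ constant. A loxodrome is a curve on a rotational surface which meets the meridians at a constant angle; here that angle is $\psi$, i.e. $\cos\psi=\langle\dot\alpha(t),\gamma_\theta'(s)\rangle$ for the unit speed curve $\alpha$. *)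

theory Defs
  imports "HOL-Analysis.Analysis"
begin

definition rotational_surface :: "(real \<Rightarrow> real) \<Rightarrow> (real \<Rightarrow> real) \<Rightarrow> real \<times> real \<Rightarrow> real ^ 3" where
  "rotational_surface f g = (\<lambda>(s, \<theta>). vector [f s * cos \<theta>, f s * sin \<theta>, g s])"

definition meridian :: "(real \<Rightarrow> real) \<Rightarrow> (real \<Rightarrow> real) \<Rightarrow> real \<Rightarrow> real \<Rightarrow> real ^ 3" where
  "meridian f g \<theta> = (\<lambda>s. rotational_surface f g (s, \<theta>))"

(* The regularity class of an immersion is taken to be C^1. *)
definition immersion_on :: "'a::euclidean_space set \<Rightarrow> ('a \<Rightarrow> 'b::euclidean_space) \<Rightarrow> bool" where
  "immersion_on U F \<longleftrightarrow> open U \<and>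
     (\<exists>F' :: 'a \<Rightarrow> 'a \<Rightarrow>\<^sub>L 'b. continuous_on U F' \<and>
       (\<forall>x\<in>U. (F has_derivative blinfun_apply (F' x)) (at x) \<and> inj (blinfun_apply (F' x))))"

(* The surface need not be embedded, so the meridian that the curve meets at parameter t is
   identified by the surface coordinates (s t, \<theta> t) rather than by the point \<alpha> t alone.
   Both \<alpha>' and the velocity of the meridian are unit vectors when the profile curve has unit
   speed, so for \<psi> in [0, pi] the last conjunct says that \<psi> is the angle between them. *)
definition unit_speed_loxodrome ::
  "(real \<Rightarrow> real) \<Rightarrow> (real \<Rightarrow> real) \<Rightarrow> real set \<Rightarrow> real set \<Rightarrow> real \<Rightarrow>
     (real \<Rightarrow> real) \<Rightarrow> (real \<Rightarrow> real) \<Rightarrow> (real \<Rightarrow> real ^ 3) \<Rightarrow> bool" where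
  "unit_speed_loxodrome f g I J \<psi> s \<theta> \<alpha> \<longleftrightarrow>
     s C1_differentiable_on J \<and> \<theta> C1_differentiable_on J \<and> \<alpha> C1_differentiable_on J \<and>
     (\<forall>t\<in>J. s t \<in> I \<and> \<alpha> t = rotational_surface f g (s t, \<theta> t) \<and>
        norm (vector_derivative \<alpha> (at t)) = 1 \<and>
        cos \<psi> = vector_derivative \<alpha> (at t) \<bullet> vector_derivative (meridian f g (\<theta> t)) (at (s t)))"

end

theory Submission
  imports Defs
begin

text \<open>In surface coordinates the metric is \<open>ds\<^sup>2 + f(s)\<^sup>2 d\<theta>\<^sup>2\<close>. Hence a curve has unit speed and makes
  the angle \<open>\<psi>\<close> with the meridians iff \<open>s' = cos \<psi>\<close> and \<open>(f(s) \<theta>')\<^sup>2 = sin\<^sup>2 \<psi>\<close>. The immersion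
  property forces \<open>f \<noteq> 0\<close>, so the continuous function \<open>f(s) \<theta>'\<close> has a constant sign on the
  parameter interval, and both equations integrate to the stated formulas.\<close>

section \<open>Derivatives of coordinate curves and of C^1 functions\<close>

lemma has_vector_derivative_vector3:
  fixes a b c :: "real \<Rightarrow> real"
  assumes "(a has_real_derivative a') (at t)" "(b has_real_derivative b') (at t)"
    "(c has_real_derivative c') (at t)"
  shows "((\<lambda>t. vector [a t, b t, c t] :: real ^ 3) has_vector_derivative vector [a', b', c']) (at t)"
proof -
  \<comment> \<open>As a combination of the axis vectors, the curve falls under the derivative rules
    for sums and scalar multiples.\<close>
  have vec: "(vector [x, y, z] :: real ^ 3) = x *\<^sub>R axis 1 1 + y *\<^sub>R axis 2 1 + z *\<^sub>R axis 3 1" for x y z :: real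
    by (simp add: vec_eq_iff forall_3 axis_def)
  show ?thesis
    unfolding vec using assms
    by (auto intro!: derivative_eq_intros)
qed

lemma has_real_derivative_C1:
  assumes "f C1_differentiable_on S" "x \<in> S"
  shows "(f has_real_derivative deriv f x) (at x)"
  using assms DERIV_deriv_iff_real_differentiable
  by (auto simp: C1_differentiable_on_eq)

lemma continuous_on_deriv_C1:
  fixes f :: "real \<Rightarrow> real"
  assumes "f C1_differentiable_on S"
  shows "continuous_on S (deriv f)"
proof -
  have "vector_derivative f (at x) = deriv f x" if "x \<in> S" for x
    using has_real_derivative_C1[OF assms that]
    by (simp add: has_real_derivative_iff_has_vector_derivative vector_derivative_at)
  moreover have "continuous_on S (\<lambda>x. vector_derivative f (at x))"
    using assms by (simp add: C1_differentiable_on_eq)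
  ultimately show ?thesis
    by (simp cong: continuous_on_cong)
qed

lemma C1_differentiable_onI_real:
  assumes "\<And>x. x \<in> S \<Longrightarrow> (f has_real_derivative f' x) (at x)" "continuous_on S f'"
  shows "f C1_differentiable_on S"
  using assms unfolding C1_differentiable_on_def has_real_derivative_iff_has_vector_derivative
  by blast

section \<open>Geometry of the surface: velocity, angle and radius\<close>

lemma rotational_curve_has_vector_derivative:
  assumes "(f has_real_derivative f') (at (s t))" "(g has_real_derivative g') (at (s t))"
    and "(s has_real_derivative s') (at t)" "(\<theta> has_real_derivative \<theta>') (at t)"
  shows "((\<lambda>t. rotational_surface f g (s t, \<theta> t)) has_vector_derivative
    vector [f' * s' * cos (\<theta> t) - f (s t) * (sin (\<theta> t) * \<theta>'),
            f' * s' * sin (\<theta> t) + f (s t) * (cos (\<theta> t) * \<theta>'), g' * s']) (at t)"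
proof -
  note fs = DERIV_chain2[OF assms(1,3)] and gs = DERIV_chain2[OF assms(2,3)]
  show ?thesis
    unfolding rotational_surface_def prod.case
    by (rule has_vector_derivative_vector3)
      (auto intro!: derivative_eq_intros fs gs assms(4) simp: algebra_simps)
qed

text \<open>The unit tangent of the meridian is orthogonal to the direction of the parallel. The
  velocity has components \<open>s'\<close> along the first and \<open>f (s t) * \<theta>'\<close>
  along the second, so its inner product with the meridian is \<open>s'\<close> and Pythagoras gives
  its length. The curve \<open>\<alpha>\<close> enters only through its derivative at
  \<open>t\<close>, so it need not coincide with the surface curve everywhere.\<close>

lemma unit_speed_angle_iff:
  assumes "(f has_real_derivative f') (at (s t))" "(g has_real_derivative g') (at (s t))"
    and "(s has_real_derivative s') (at t)" "(\<theta> has_real_derivative \<theta>') (at t)"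
    and unit: "f'\<^sup>2 + g'\<^sup>2 = 1"
    and \<alpha>: "(\<alpha> has_vector_derivative v) (at t)"
      "((\<lambda>t. rotational_surface f g (s t, \<theta> t)) has_vector_derivative v) (at t)"
  shows "norm (vector_derivative \<alpha> (at t)) = 1 \<and>
      cos \<psi> = vector_derivative \<alpha> (at t) \<bullet> vector_derivative (meridian f g (\<theta> t)) (at (s t))
    \<longleftrightarrow> s' = cos \<psi> \<and> (f (s t) * \<theta>')\<^sup>2 = (sin \<psi>)\<^sup>2"
proof -
  have v: "v = vector [f' * s' * cos (\<theta> t) - f (s t) * (sin (\<theta> t) * \<theta>'),
            f' * s' * sin (\<theta> t) + f (s t) * (cos (\<theta> t) * \<theta>'), g' * s']"
    using vector_derivative_unique_at[OF \<alpha>(2) rotational_curve_has_vector_derivative[OF assms(1-4)]] .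
  have "(meridian f g (\<theta> t) has_vector_derivative
      vector [f' * cos (\<theta> t), f' * sin (\<theta> t), g']) (at (s t))"
    \<comment> \<open>A meridian is the coordinate curve with \<open>s\<close> the identity and
      \<theta> constant.\<close>
    using rotational_curve_has_vector_derivative[where s = "\<lambda>x. x" and \<theta> = "\<lambda>x. \<theta> t" and s' = 1 and \<theta>' = 0,
        OF assms(1,2)]
    by (simp add: meridian_def)
  then have m: "vector_derivative (meridian f g (\<theta> t)) (at (s t)) = vector [f' * cos (\<theta> t), f' * sin (\<theta> t), g']"
    by (rule vector_derivative_at)
  have \<alpha>': "vector_derivative \<alpha> (at t) = v"
    using \<alpha>(1) by (rule vector_derivative_at)
  have cs: "(cos (\<theta> t))\<^sup>2 + (sin (\<theta> t))\<^sup>2 = 1" by simp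
  have "(norm v)\<^sup>2 = v \<bullet> v"
    by (simp add: power2_norm_eq_inner)
  \<comment> \<open>The sum of the squares of cosine and sine is left unevaluated, which makes this
    a pure polynomial identity; \<open>cs\<close> and \<open>unit\<close> reduce it
    afterwards.\<close>
  also have "\<dots> = s'\<^sup>2 * (f'\<^sup>2 * ((cos (\<theta> t))\<^sup>2 + (sin (\<theta> t))\<^sup>2) + g'\<^sup>2)
      + (f (s t) * \<theta>')\<^sup>2 * ((cos (\<theta> t))\<^sup>2 + (sin (\<theta> t))\<^sup>2)"
    unfolding v inner_vec_def sum_3 vector_3 inner_real_def by algebra
  finally have n: "(norm v)\<^sup>2 = s'\<^sup>2 + (f (s t) * \<theta>')\<^sup>2"
    unfolding cs using unit by simp
  have "v \<bullet> vector [f' * cos (\<theta> t), f' * sin (\<theta> t), g'] =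
     s' * (f'\<^sup>2 * ((cos (\<theta> t))\<^sup>2 + (sin (\<theta> t))\<^sup>2) + g'\<^sup>2)"
    unfolding v inner_vec_def sum_3 vector_3 inner_real_def by algebra
  then have i: "v \<bullet> vector [f' * cos (\<theta> t), f' * sin (\<theta> t), g'] = s'"
    unfolding cs using unit by simp
  have "norm v = 1 \<longleftrightarrow> (norm v)\<^sup>2 = 1"
    by (simp add: power2_eq_1_iff) (use norm_ge_zero[of v] in linarith)
  then have "norm v = 1 \<and> cos \<psi> = s' \<longleftrightarrow> s' = cos \<psi> \<and> (f (s t) * \<theta>')\<^sup>2 = 1 - (cos \<psi>)\<^sup>2"
    unfolding n by auto
  then show ?thesis
    unfolding \<alpha>' m i sin_squared_eq .
qed

text \<open>On the axis \<open>f = 0\<close> the velocity of the parallel circle vanishes.\<close>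

lemma immersion_radius_nonzero:
  assumes "immersion_on (I \<times> UNIV) (rotational_surface f g)" "s \<in> I"
  shows "f s \<noteq> 0"
proof
  assume 0: "f s = 0"
  from assms obtain F' where F': "(rotational_surface f g has_derivative blinfun_apply F') (at (s, 0))"
    and inj: "inj (blinfun_apply F')"
    unfolding immersion_on_def by blast
  \<comment> \<open>Composing with this line isolates the partial derivative in the direction
    \<open>(0, 1)\<close>. The parallel has collapsed to a point, so that derivative is zero,
    against injectivity.\<close>
  have "((\<lambda>\<theta>::real. (s, \<theta>)) has_derivative (\<lambda>h. (0, h))) (at 0)"
    by (auto intro!: derivative_eq_intros)
  from has_derivative_compose[OF this, of "rotational_surface f g" F'] F'
  have "((\<lambda>\<theta>. rotational_surface f g (s, \<theta>)) has_derivative (\<lambda>h. F' (0, h))) (at 0)"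
    by simp
  moreover have "(\<lambda>\<theta>. rotational_surface f g (s, \<theta>)) = (\<lambda>\<theta>. vector [0, 0, g s])"
    by (simp add: rotational_surface_def 0)
  ultimately have "((\<lambda>\<theta>::real. vector [0, 0, g s] :: real ^ 3) has_derivative (\<lambda>h. F' (0, h))) (at 0)"
    by simp
  from has_derivative_unique[OF this has_derivative_const]
  have "blinfun_apply F' (0, 1) = 0" by metis
  then have "blinfun_apply F' (0, 1) = F' (0, 0)"
    by (simp flip: zero_prod_def)
  then show False
    using inj by (auto dest: injD)
qed

section \<open>Integration on an open interval and constancy of sign\<close>

text \<open>The fundamental theorem of calculus on a compact interval inside \<open>J\<close> that
  has both \<open>t0\<close> and \<open>t\<close> in its interior. This yields a two-sided
  derivative, whichever of the two points is the smaller.\<close>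

lemma interval_integral_has_real_derivative:
  fixes h :: "real \<Rightarrow> real"
  assumes "open J" "is_interval J" "continuous_on J h" "t0 \<in> J" "t \<in> J"
  shows "((\<lambda>u. LBINT \<xi>=t0..u. h \<xi>) has_real_derivative h t) (at t)"
proof -
  \<comment> \<open>Openness of \<open>J\<close> leaves room below the smaller and above the larger
    of the two points.\<close>
  obtain e where e: "e > 0" "cball (min t0 t) e \<subseteq> J"
    using assms open_contains_cball[of J] by (metis min_def)
  obtain d where d: "d > 0" "cball (max t0 t) d \<subseteq> J"
    using assms open_contains_cball[of J] by (metis max_def)
  define a b where "a = min t0 t - e" and "b = max t0 t + d"
  have "a \<in> J" "b \<in> J"
    using e d by (auto simp: a_def b_def subset_iff dist_real_def)
  then have "{a..b} \<subseteq> J"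
    using assms(2) unfolding is_interval_1 by (meson atLeastAtMost_iff subsetI)
  then have "continuous_on {a..b} h"
    using assms(3) continuous_on_subset by blast
  moreover have ab: "a < t0" "t0 < b" "a < t" "t < b"
    using e d by (auto simp: a_def b_def)
  ultimately have "((\<lambda>u. LBINT \<xi>=t0..u. h \<xi>) has_vector_derivative h t) (at t within {a..b})"
    by (intro interval_integral_FTC2) auto
  moreover have "at t within {a..b} = at t"
    using ab by (intro at_within_interior) auto
  ultimately show ?thesis
    by (simp add: has_real_derivative_iff_has_vector_derivative)
qed

text \<open>A continuous image of a connected set that lies in the finite set \<open>{k, -k}\<close>
  has at most one point. The case \<open>k = 0\<close> is included, where both signs agree.\<close>

lemma constant_sign_if_square_const:
  fixes h :: "'a::topological_space \<Rightarrow> real"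
  assumes "connected J" "continuous_on J h" "\<And>t. t \<in> J \<Longrightarrow> (h t)\<^sup>2 = k\<^sup>2"
  obtains \<epsilon> where "\<epsilon> \<in> {-1, 1}" "\<And>t. t \<in> J \<Longrightarrow> h t = \<epsilon> * k"
proof -
  have "h ` J \<subseteq> {k, -k}"
    using assms(3) by (auto simp: power2_eq_iff)
  then have "finite (h ` J)"
    by (rule finite_subset) simp
  moreover have "connected (h ` J)"
    using assms(1,2) connected_continuous_image by blast
  ultimately obtain y where "h ` J \<subseteq> {y}"
    using connected_finite_iff_sing by (metis empty_subsetI subset_refl)
  with \<open>h ` J \<subseteq> {k, -k}\<close> have "(\<forall>t\<in>J. h t = k) \<or> (\<forall>t\<in>J. h t = -k)"
    by blast
  then show ?thesis
    using that[of 1] that[of "-1"] by auto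
qed

section \<open>Loxodromes and their coordinate equations\<close>

text \<open>The pointwise criterion \<open>unit_speed_angle_iff\<close> read from right to left;
  what remains is the C^1 regularity of the curve. The derivative \<open>\<theta>'\<close> is
  explicit so that its continuity can be read off a formula.\<close>

lemma unit_speed_loxodromeI:
  assumes "f C1_differentiable_on I" "g C1_differentiable_on I"
    and unit: "\<forall>s\<in>I. (deriv f s)\<^sup>2 + (deriv g s)\<^sup>2 = 1"
    and s: "\<And>t. t \<in> J \<Longrightarrow> (s has_real_derivative cos \<psi>) (at t)" "\<And>t. t \<in> J \<Longrightarrow> s t \<in> I"
    and \<theta>: "\<And>t. t \<in> J \<Longrightarrow> (\<theta> has_real_derivative \<theta>' t) (at t)" "continuous_on J \<theta>'"
      "\<And>t. t \<in> J \<Longrightarrow> (f (s t) * \<theta>' t)\<^sup>2 = (sin \<psi>)\<^sup>2"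
  shows "unit_speed_loxodrome f g I J \<psi> s \<theta> (\<lambda>t. rotational_surface f g (s t, \<theta> t))"
proof -
  define v :: "real \<Rightarrow> real ^ 3" where
    "v t = vector [deriv f (s t) * cos \<psi> * cos (\<theta> t) - f (s t) * (sin (\<theta> t) * \<theta>' t),
            deriv f (s t) * cos \<psi> * sin (\<theta> t) + f (s t) * (cos (\<theta> t) * \<theta>' t), deriv g (s t) * cos \<psi>]" for t
  have v: "((\<lambda>t. rotational_surface f g (s t, \<theta> t)) has_vector_derivative v t) (at t)" if "t \<in> J" for t
    unfolding v_def
    by (intro rotational_curve_has_vector_derivative has_real_derivative_C1[of _ I] assms that)
  have conts: "continuous_on J s"
    using s(1) by (meson DERIV_continuous_on has_field_derivative_at_within)
  have cont\<theta>: "continuous_on J \<theta>"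
    using \<theta>(1) by (meson DERIV_continuous_on has_field_derivative_at_within)
  have sub: "s ` J \<subseteq> I" using s(2) by blast
  have contf: "continuous_on I f"
    using has_real_derivative_C1[OF assms(1)] by (meson DERIV_continuous_on has_field_derivative_at_within)
  have "continuous_on J (\<lambda>t. deriv f (s t))" "continuous_on J (\<lambda>t. deriv g (s t))" "continuous_on J (\<lambda>t. f (s t))"
    using assms(1,2) conts contf sub by (blast intro: continuous_on_compose2 continuous_on_deriv_C1)+
  then have "continuous_on J v"
    \<comment> \<open>Continuity of the velocity is checked component by component.\<close>
    using cont\<theta> \<theta>(2) unfolding continuous_on_componentwise[of _ v]
    by (auto simp: Basis_vec_def inner_axis v_def exhaust_3 UNIV_3 intro!: continuous_intros)
  with v have "(\<lambda>t. rotational_surface f g (s t, \<theta> t)) C1_differentiable_on J"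
    unfolding C1_differentiable_on_def by blast
  moreover have "s C1_differentiable_on J" "\<theta> C1_differentiable_on J"
    using C1_differentiable_onI_real[OF s(1) continuous_on_const] C1_differentiable_onI_real[OF \<theta>(1,2)]
    by blast+
  ultimately show ?thesis
    unfolding unit_speed_loxodrome_def
    using unit_speed_angle_iff[OF has_real_derivative_C1[OF assms(1) s(2)] has_real_derivative_C1[OF assms(2) s(2)]
      s(1) \<theta>(1) unit[rule_format, OF s(2)] v v, of _ \<psi>] s(2) \<theta>(3)
    by simp
qed

text \<open>The same criterion read from left to right. As \<open>\<alpha>\<close> is the surface
  curve only on \<open>J\<close>, openness of \<open>J\<close> is what transfers the derivative to
  it.\<close>

lemma unit_speed_loxodromeD:
  assumes "open J" "f C1_differentiable_on I" "g C1_differentiable_on I"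
    and unit: "\<forall>s\<in>I. (deriv f s)\<^sup>2 + (deriv g s)\<^sup>2 = 1"
    and lox: "unit_speed_loxodrome f g I J \<psi> s \<theta> \<alpha>" and t: "t \<in> J"
  shows "deriv s t = cos \<psi>" "(f (s t) * deriv \<theta> t)\<^sup>2 = (sin \<psi>)\<^sup>2"
proof -
  have s: "s C1_differentiable_on J" "s t \<in> I" and \<theta>: "\<theta> C1_differentiable_on J"
    and \<alpha>: "\<And>u. u \<in> J \<Longrightarrow> \<alpha> u = rotational_surface f g (s u, \<theta> u)"
    and ang: "norm (vector_derivative \<alpha> (at t)) = 1"
      "cos \<psi> = vector_derivative \<alpha> (at t) \<bullet> vector_derivative (meridian f g (\<theta> t)) (at (s t))"
    using lox t unfolding unit_speed_loxodrome_def by auto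
  note d = has_real_derivative_C1[OF assms(2) s(2)] has_real_derivative_C1[OF assms(3) s(2)]
    has_real_derivative_C1[OF s(1) t] has_real_derivative_C1[OF \<theta> t]
  note r = rotational_curve_has_vector_derivative[OF d]
  have "deriv s t = cos \<psi> \<and> (f (s t) * deriv \<theta> t)\<^sup>2 = (sin \<psi>)\<^sup>2"
    using unit_speed_angle_iff[OF d unit[rule_format, OF s(2)]
        has_vector_derivative_transform_within_open[OF r assms(1) t \<alpha>[symmetric]] r, of \<psi>] ang by blast
  then show "deriv s t = cos \<psi>" "(f (s t) * deriv \<theta> t)\<^sup>2 = (sin \<psi>)\<^sup>2" by auto
qed


theorem theorem3:
  fixes f g :: "real \<Rightarrow> real" and I J :: "real set" and \<psi> :: real
  assumes "open I" and "is_interval I"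
    and "open J" and "is_interval J"
    and "f C1_differentiable_on I" and "g C1_differentiable_on I"
    and "\<forall>s\<in>I. (deriv f s)\<^sup>2 + (deriv g s)\<^sup>2 = 1"
    and "immersion_on (I \<times> UNIV) (rotational_surface f g)"
    and "\<psi> \<in> {0..pi}"
  shows "(\<forall>c. \<forall>t0\<in>J. \<forall>\<epsilon>\<in>{-1, 1}.
            (\<forall>t\<in>J. cos \<psi> * t + c \<in> I) \<longrightarrow>
            (let s = (\<lambda>t. cos \<psi> * t + c);
                 \<theta> = (\<lambda>t::real. \<epsilon> * sin \<psi> * (LBINT \<xi>=t0..t. 1 / f (s \<xi>)))
             in unit_speed_loxodrome f g I J \<psi> s \<theta>
                  (\<lambda>t. vector [f (s t) * cos (\<theta> t), f (s t) * sin (\<theta> t), g (s t)])))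
       \<and> (\<forall>s \<theta> \<alpha>. unit_speed_loxodrome f g I J \<psi> s \<theta> \<alpha> \<longrightarrow>
            (\<forall>t0\<in>J. \<exists>c. \<exists>\<epsilon>\<in>{-1, 1}. \<exists>\<theta>0. \<forall>t\<in>J.
               s t = cos \<psi> * t + c \<and>
               \<theta> t = \<theta>0 + \<epsilon> * sin \<psi> * (LBINT \<xi>=t0..t. 1 / f (s \<xi>)) \<and>
               \<alpha> t = vector [f (s t) * cos (\<theta> t), f (s t) * sin (\<theta> t), g (s t)]))"
proof -
  have f0: "f x \<noteq> 0" if "x \<in> I" for x
    using immersion_radius_nonzero[OF assms(8) that] .
  have contf: "continuous_on I f"
    using has_real_derivative_C1[OF assms(5)] by (meson DERIV_continuous_on has_field_derivative_at_within)
  have cont: "continuous_on J (\<lambda>\<xi>. f (s \<xi>))" "continuous_on J (\<lambda>\<xi>. 1 / f (s \<xi>))"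
    if "continuous_on J s" "\<forall>t\<in>J. s t \<in> I" for s
  proof -
    show "continuous_on J (\<lambda>\<xi>. f (s \<xi>))"
      using that contf by (blast intro: continuous_on_compose2)
    then show "continuous_on J (\<lambda>\<xi>. 1 / f (s \<xi>))"
      using f0 that(2) by (auto intro!: continuous_intros)
  qed
  note FTC = interval_integral_has_real_derivative[OF assms(3,4)]
  show ?thesis
  proof (intro conjI allI ballI impI)
    fix c t0 \<epsilon> :: real
    assume t0: "t0 \<in> J" and \<epsilon>: "\<epsilon> \<in> {-1, 1}" and sI: "\<forall>t\<in>J. cos \<psi> * t + c \<in> I"
    define s where "s t = cos \<psi> * t + c" for t
    define \<theta> where "\<theta> t = \<epsilon> * sin \<psi> * (LBINT \<xi>=t0..t. 1 / f (s \<xi>))" for t :: real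
    have sI: "\<forall>t\<in>J. s t \<in> I" using sI by (simp add: s_def)
    have c1: "continuous_on J (\<lambda>\<xi>. 1 / f (s \<xi>))"
      by (rule cont(2)[OF _ sI]) (auto simp: s_def intro!: continuous_intros)
    have "unit_speed_loxodrome f g I J \<psi> s \<theta> (\<lambda>t. rotational_surface f g (s t, \<theta> t))"
    \<comment> \<open>With this derivative \<open>f (s t) * \<theta>'\<close> equals \<epsilon> sin
      \<psi>, whose square does not depend on the sign.\<close>
    proof (rule unit_speed_loxodromeI[where \<theta>' = "\<lambda>t. \<epsilon> * sin \<psi> * (1 / f (s t))"])
      fix t assume t: "t \<in> J"
      show "(s has_real_derivative cos \<psi>) (at t)"
        unfolding s_def by (auto intro!: derivative_eq_intros)
      show "(\<theta> has_real_derivative \<epsilon> * sin \<psi> * (1 / f (s t))) (at t)"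
        unfolding \<theta>_def by (intro DERIV_cmult FTC c1 t0 t)
      show "(f (s t) * (\<epsilon> * sin \<psi> * (1 / f (s t))))\<^sup>2 = (sin \<psi>)\<^sup>2"
        using f0 sI t \<epsilon> by (auto simp: power_mult_distrib)
    next
      show "continuous_on J (\<lambda>t. \<epsilon> * sin \<psi> * (1 / f (s t)))"
        by (intro continuous_intros c1)
    qed (use assms sI in auto)
    then show "let s = (\<lambda>t. cos \<psi> * t + c);
                 \<theta> = (\<lambda>t::real. \<epsilon> * sin \<psi> * (LBINT \<xi>=t0..t. 1 / f (s \<xi>)))
             in unit_speed_loxodrome f g I J \<psi> s \<theta>
                  (\<lambda>t. vector [f (s t) * cos (\<theta> t), f (s t) * sin (\<theta> t), g (s t)])"
      unfolding Let_def rotational_surface_def prod.case \<theta>_def[abs_def] s_def[abs_def] .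
  next
    fix s \<theta> :: "real \<Rightarrow> real" and \<alpha> t0
    assume lox: "unit_speed_loxodrome f g I J \<psi> s \<theta> \<alpha>" and t0: "t0 \<in> J"
    have s: "s C1_differentiable_on J" and sI: "\<forall>t\<in>J. s t \<in> I" and \<theta>: "\<theta> C1_differentiable_on J"
      and \<alpha>: "\<And>t. t \<in> J \<Longrightarrow> \<alpha> t = rotational_surface f g (s t, \<theta> t)"
      using lox unfolding unit_speed_loxodrome_def by auto
    note D = unit_speed_loxodromeD[OF assms(3,5-7) lox]
    have ds: "(s has_real_derivative cos \<psi>) (at t)" if "t \<in> J" for t
      using has_real_derivative_C1[OF s that] D(1)[OF that] by simp
    then have "continuous_on J s"
      by (meson DERIV_continuous_on has_field_derivative_at_within)
    note c = cont[OF this sI]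
    have conv: "convex J" "connected J"
      using assms(4) by (auto simp: is_interval_convex is_interval_connected)
    \<comment> \<open>Its square is the constant sin^2 \<psi>, so continuity on the connected set
      \<open>J\<close> fixes one sign \<epsilon> for all parameters.\<close>
    have "continuous_on J (\<lambda>t. f (s t) * deriv \<theta> t)"
      by (intro continuous_intros c continuous_on_deriv_C1 \<theta>)
    from constant_sign_if_square_const[OF conv(2) this D(2)]
    obtain \<epsilon> where \<epsilon>: "\<epsilon> \<in> {-1, 1}" "\<And>t. t \<in> J \<Longrightarrow> f (s t) * deriv \<theta> t = \<epsilon> * sin \<psi>" by metis
    \<comment> \<open>Dividing by the nonzero radius shows that \<theta> and the integral expression
      have the same derivative, so they differ by a constant on the convex set \<open>J\<close>.
      That constant \<open>\<theta>0\<close> is the value of \<theta> at \<open>t0\<close>, where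
      the integral vanishes; it amounts to a rotation about the axis.\<close>
    have "((\<lambda>t. \<theta> t - \<epsilon> * sin \<psi> * (LBINT \<xi>=t0..t. 1 / f (s \<xi>))) has_real_derivative 0) (at t within J)"
      if "t \<in> J" for t
    proof -
      have "deriv \<theta> t - \<epsilon> * sin \<psi> * (1 / f (s t)) = 0"
        using \<epsilon>(2)[OF that] f0 sI that by (simp add: field_simps)
      with DERIV_diff[OF has_real_derivative_C1[OF \<theta> that] DERIV_cmult[OF FTC[OF c(2) t0 that], of "\<epsilon> * sin \<psi>"]]
      show ?thesis by (simp add: has_field_derivative_at_within)
    qed
    from has_field_derivative_zero_constant[OF conv(1) this] obtain \<theta>0 where
      \<theta>0: "\<And>t. t \<in> J \<Longrightarrow> \<theta> t - \<epsilon> * sin \<psi> * (LBINT \<xi>=t0..t. 1 / f (s \<xi>)) = \<theta>0" by metis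
    \<comment> \<open>The constant \<open>c\<close> arises likewise, from s' = cos \<psi>.\<close>
    have "((\<lambda>t. s t - cos \<psi> * t) has_real_derivative 0) (at t within J)" if "t \<in> J" for t
      by (rule has_field_derivative_at_within) (auto intro!: derivative_eq_intros ds that)
    from has_field_derivative_zero_constant[OF conv(1) this] obtain c where
      c: "\<And>t. t \<in> J \<Longrightarrow> s t - cos \<psi> * t = c" by metis
    show "\<exists>c. \<exists>\<epsilon>\<in>{-1, 1}. \<exists>\<theta>0. \<forall>t\<in>J.
               s t = cos \<psi> * t + c \<and>
               \<theta> t = \<theta>0 + \<epsilon> * sin \<psi> * (LBINT \<xi>=t0..t. 1 / f (s \<xi>)) \<and>
               \<alpha> t = vector [f (s t) * cos (\<theta> t), f (s t) * sin (\<theta> t), g (s t)]"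
    proof (intro exI bexI ballI conjI)
      fix t assume t: "t \<in> J"
      show "s t = cos \<psi> * t + c" using c[OF t] by simp
      show "\<theta> t = \<theta>0 + \<epsilon> * sin \<psi> * (LBINT \<xi>=t0..t. 1 / f (s \<xi>))"
        using \<theta>0[OF t] by simp
      show "\<alpha> t = vector [f (s t) * cos (\<theta> t), f (s t) * sin (\<theta> t), g (s t)]"
        using \<alpha>[OF t] by (simp add: rotational_surface_def)
    qed (use \<epsilon> in auto)
  qed
qed

end
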